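(* Let $k\geq2$ be an integer. The pull-back by $\overline{\phi_k}:\mathbb{R}^2/G'\to D_{2k+1}^+\subset\mathbb{R}^3$ is a Poisson morphism $$\overline{\phi_k}^*:C^\infty(\mathbb{R}^3)\to C^{\lfloor k/2\rfloor}(\mathbb{R}^2/G'),$$ i.e. it is an algebra morphism with values in $C^{\lfloor k/2\rfloor}(\mathbb{R}^2/G')$ which satisfies $\{\overline{\phi_k}^*F,\overline{\phi_k}^*H\}=\overline{\phi_k}^*\{F,H\}$ for all $F,H\in C^\infty(\mathbb{R}^3)$. It restricts (on polynomial functions) to a Poisson algebra isomorphism $\overline{\phi_k}^*:\mathcal{F}(D_{2k+1})\simeq\mathcal{A}'$.
   Context: $\mathbb{R}^2$ has coordinates $(p,q)$ and bracket $\{f,g\}=\frac{q}{2\pi}\left(\frac{\partial f}{\partial p}\frac{\partial g}{\partial q}-\frac{\partial f}{\partial q}\frac{\partial g}{\partial p}\right)$, defined for differentiable functions. $G'=\left\{\begin{pmatrix}1&n\\0&\epsilon\end{pmatrix}: n\in\mathbb{Z},\epsilon\in\{\pm1\}\right\}$ acts by $(n,\epsilon)\cdot(p,q)=(p+nq,\epsilon q)$; $\mathbb{R}^2/G'$ is the quotient by the closed equivalence relation identifying points of the same orbit and identifying all points $(p,0)$. Here $C^{\lfloor k/2\rfloor}(\mathbb{R}^2/G')$ denotes the algebra of $G'$-invariant functions on $\mathbb{R}^2$ which are $\lfloor k/2\rfloor$ times differentiable on $\mathbb{R}^2$ and smooth outside the line $q=0$. $\phi_k:\mathbb{R}^2\to\mathbb{R}^3$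 is $\phi_k(p,q)=\left(q^{2k}\cos\frac{2\pi p}{q},q^{2k+1}\sin\frac{2\pi p}{q},q^2\right)$ for $q\ne0$, $\phi_k(p,0)=0$; it takes values in $D_{2k+1}^+:=(D_{2k+1}\cap\{z>0\})\cup\{0\}$, where $D_{2k+1}=\{zx^2+y^2=z^{2k+1}\}\subset\mathbb{R}^3$, and induces $\overline{\phi_k}$ on $\mathbb{R}^2/G'$. $\mathcal{A}'$ is the algebra of functions on $\mathbb{R}^2/G'$ generated by the three components of $\phi_k$; it is stable under the bracket above. $C^\infty(\mathbb{R}^3)$ carries the Poisson bracket determined by $\{x,y\}=x^2-(2k+1)z^{2k}$, $\{y,z\}=2zx$, $\{z,x\}=2y$, for which $zx^2+y^2-z^{2k+1}$ is a Casimir; hence it descends to $\mathcal{F}(D_{2k+1})=\mathbb{R}[x,y,z]/(zx^2+y^2-z^{2k+1})$, the algebra of polynomial functions. *)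

theory Defs
  imports "HOL-Analysis.Analysis" "HOL-Algebra.QuotRing" "HOL-Algebra.Module"
begin

section \<open>Differentiability classes and partial derivatives\<close>

text \<open>For open \<open>S\<close>: all derivatives of \<open>f\<close> up to order \<open>n\<close> exist and are continuous
  on \<open>S\<close>, i.e. \<open>f\<close> is of class \<open>C\<^sup>n\<close>.\<close>

primrec Cn_on :: "nat \<Rightarrow> 'a::euclidean_space set \<Rightarrow> ('a \<Rightarrow> real) \<Rightarrow> bool" where
  "Cn_on 0 S f \<longleftrightarrow> continuous_on S f"
| "Cn_on (Suc n) S f \<longleftrightarrow>
     (\<forall>x\<in>S. f differentiable (at x)) \<and>
     (\<forall>v. Cn_on n S (\<lambda>x. frechet_derivative f (at x) v))"

definition smooth_on :: "'a::euclidean_space set \<Rightarrow> ('a \<Rightarrow> real) \<Rightarrow> bool" where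
  "smooth_on S f \<longleftrightarrow> (\<forall>n. Cn_on n S f)"

definition partial :: "'n::finite \<Rightarrow> (real^'n \<Rightarrow> real) \<Rightarrow> real^'n \<Rightarrow> real" where
  "partial i f w = frechet_derivative f (at w) (axis i 1)"


section \<open>Real algebras with a bracket\<close>

text \<open>Carrier-based commutative real algebras carrying a binary bracket. No axioms are built in;
  in particular the carrier need not be stable under the bracket, as is the case for the
  algebra of \<open>n\<close> times differentiable functions.\<close>

record 'b bracket_alg = "(real, 'b) module" +
  pbracket :: "'b \<Rightarrow> 'b \<Rightarrow> 'b"

definition fun_alg ::
    "('a \<Rightarrow> real) set \<Rightarrow> (('a \<Rightarrow> real) \<Rightarrow> ('a \<Rightarrow> real) \<Rightarrow> ('a \<Rightarrow> real)) \<Rightarrow> ('a \<Rightarrow> real) bracket_alg" where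
  "fun_alg S br =
    \<lparr>carrier = S, mult = (\<lambda>f g x. f x * g x), one = (\<lambda>x. 1),
     zero = (\<lambda>x. 0), add = (\<lambda>f g x. f x + g x),
     smult = (\<lambda>c f x. c * f x), pbracket = br\<rparr>"

text \<open>The quotient by an ideal \<open>I\<close>. As for \<^const>\<open>rcoset_mult\<close>, the operations on cosets are
  unions over all representatives; thus the bracket of two cosets is again a coset
  exactly when the bracket descends.\<close>

definition quot_alg :: "'b bracket_alg \<Rightarrow> 'b set \<Rightarrow> 'b set bracket_alg" where
  "quot_alg A I =
    \<lparr>carrier = carrier (A Quot I), mult = mult (A Quot I), one = one (A Quot I),
     zero = zero (A Quot I), add = add (A Quot I),
     smult = (\<lambda>c X. \<Union>f\<in>X. I +>\<^bsub>A\<^esub> smult A c f),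
     pbracket = (\<lambda>X Y. \<Union>f\<in>X. \<Union>g\<in>Y. I +>\<^bsub>A\<^esub> pbracket A f g)\<rparr>"

definition bracket_closed :: "'b bracket_alg \<Rightarrow> bool" where
  "bracket_closed A \<longleftrightarrow> (\<forall>f\<in>carrier A. \<forall>g\<in>carrier A. pbracket A f g \<in> carrier A)"

definition alg_hom :: "'b bracket_alg \<Rightarrow> 'c bracket_alg \<Rightarrow> ('b \<Rightarrow> 'c) set" where
  "alg_hom A B =
    {h \<in> ring_hom A B. \<forall>c. \<forall>f\<in>carrier A. h (smult A c f) = smult B c (h f)}"

definition poisson_hom :: "'b bracket_alg \<Rightarrow> 'c bracket_alg \<Rightarrow> ('b \<Rightarrow> 'c) set" where
  "poisson_hom A B =
    {h \<in> alg_hom A B. \<forall>f\<in>carrier A. \<forall>g\<in>carrier A.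
       h (pbracket A f g) = pbracket B (h f) (h g)}"

definition poisson_iso :: "'b bracket_alg \<Rightarrow> 'c bracket_alg \<Rightarrow> ('b \<Rightarrow> 'c) set" where
  "poisson_iso A B =
    {h \<in> poisson_hom A B. bij_betw h (carrier A) (carrier B) \<and>
       bracket_closed A \<and> bracket_closed B}"

inductive_set gen_alg :: "('a \<Rightarrow> real) set \<Rightarrow> ('a \<Rightarrow> real) set" for S where
  base: "f \<in> S \<Longrightarrow> f \<in> gen_alg S"
| const: "(\<lambda>x. c) \<in> gen_alg S"
| add: "f \<in> gen_alg S \<Longrightarrow> g \<in> gen_alg S \<Longrightarrow> (\<lambda>x. f x + g x) \<in> gen_alg S"
| mult: "f \<in> gen_alg S \<Longrightarrow> g \<in> gen_alg S \<Longrightarrow> (\<lambda>x. f x * g x) \<in> gen_alg S"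


section \<open>The plane modulo \<open>G'\<close>\<close>

text \<open>Coordinates: \<open>p = w $ 1\<close>, \<open>q = w $ 2\<close>. The matrix with parameters \<open>n\<close>, \<open>e\<close> sends
  \<open>(p, q)\<close> to \<open>(p + n q, e q)\<close>, which is matrix-vector multiplication.\<close>

definition G' :: "(real^2^2) set" where
  "G' = {vector [vector [1, of_int n], vector [0, e]] | (n::int) e. e \<in> {1, -1}}"

definition orbit_rel :: "real^2 \<Rightarrow> real^2 \<Rightarrow> bool" where
  "orbit_rel v w \<longleftrightarrow> (\<exists>A\<in>G'. w = A *v v) \<or> (v $ 2 = 0 \<and> w $ 2 = 0)"

lemma G'_action:
  "(vector [vector [1, of_int n], vector [0, e]] :: real^2^2) *v w =
     vector [w $ 1 + of_int n * w $ 2, e * w $ 2]"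
  by (simp add: vec_eq_iff forall_2 matrix_vector_mult_def sum_2)

lemma orbit_rel_iff:
  "orbit_rel v w \<longleftrightarrow>
     (\<exists>(n::int) e. e \<in> {1, -1} \<and> w $ 1 = v $ 1 + of_int n * v $ 2 \<and> w $ 2 = e * v $ 2) \<or>
     (v $ 2 = 0 \<and> w $ 2 = 0)"
proof -
  have "(\<exists>A\<in>G'. w = A *v v) \<longleftrightarrow>
    (\<exists>(n::int) e. e \<in> {1, -1} \<and> w = (vector [vector [1, of_int n], vector [0, e]] :: real^2^2) *v v)"
    unfolding G'_def by blast
  also have "\<dots> \<longleftrightarrow>
    (\<exists>(n::int) e. e \<in> {1, -1} \<and> w $ 1 = v $ 1 + of_int n * v $ 2 \<and> w $ 2 = e * v $ 2)"
    unfolding G'_action by (simp add: vec_eq_iff forall_2)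
  finally show ?thesis unfolding orbit_rel_def by simp
qed

lemma orbit_rel_cases:
  assumes "orbit_rel v w"
  obtains (line) "v $ 2 = 0" "w $ 2 = 0"
    | (plus) n :: int where "w $ 1 = v $ 1 + of_int n * v $ 2" "w $ 2 = v $ 2"
    | (minus) n :: int where "w $ 1 = v $ 1 + of_int n * v $ 2" "w $ 2 = - v $ 2"
proof -
  have "(v $ 2 = 0 \<and> w $ 2 = 0)
    \<or> (\<exists>n::int. w $ 1 = v $ 1 + of_int n * v $ 2 \<and> w $ 2 = v $ 2)
    \<or> (\<exists>n::int. w $ 1 = v $ 1 + of_int n * v $ 2 \<and> w $ 2 = - v $ 2)"
    using assms unfolding orbit_rel_iff by fastforce
  then show thesis using that by blast
qed

lemma equivp_orbit_rel: "equivp orbit_rel"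
proof (rule equivpI)
  show "reflp orbit_rel"
  proof (rule reflpI)
    fix v show "orbit_rel v v"
      unfolding orbit_rel_iff by (rule disjI1, rule exI[of _ 0], rule exI[of _ 1]) simp
  qed
  show "symp orbit_rel"
  proof (rule sympI)
    fix v w assume "orbit_rel v w"
    then show "orbit_rel w v"
    proof (cases rule: orbit_rel_cases)
      case line then show ?thesis unfolding orbit_rel_iff by simp
    next
      case (plus n) then show ?thesis
        unfolding orbit_rel_iff by (intro disjI1 exI[of _ "-n"] exI[of _ 1]) simp
    next
      case (minus n) then show ?thesis
        unfolding orbit_rel_iff by (intro disjI1 exI[of _ n] exI[of _ "-1"]) simp
    qed
  qed
  show "transp orbit_rel"
  proof (rule transpI)
    fix u v w assume "orbit_rel u v" "orbit_rel v w"
    show "orbit_rel u w"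
    proof (cases "u $ 2 = 0 \<or> v $ 2 = 0 \<or> w $ 2 = 0")
      case True
      then have "u $ 2 = 0 \<and> w $ 2 = 0"
        using \<open>orbit_rel u v\<close> \<open>orbit_rel v w\<close> unfolding orbit_rel_iff by auto
      then show ?thesis unfolding orbit_rel_iff by simp
    next
      case False
      then obtain n m :: int and d e :: real where
        *: "d \<in> {1, -1}" "v $ 1 = u $ 1 + of_int n * u $ 2" "v $ 2 = d * u $ 2"
           "e \<in> {1, -1}" "w $ 1 = v $ 1 + of_int m * v $ 2" "w $ 2 = e * v $ 2"
        using \<open>orbit_rel u v\<close> \<open>orbit_rel v w\<close> unfolding orbit_rel_iff by blast
      define c :: int where "c = (if d = 1 then 1 else -1)"
      have "d = of_int c" using *(1) by (auto simp: c_def)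
      with * show ?thesis
        unfolding orbit_rel_iff
        by (intro disjI1 exI[of _ "n + m * c"] exI[of _ "e * d"]) (auto simp: algebra_simps)
    qed
  qed
qed

quotient_type plane_mod_G' = "real^2" / orbit_rel
  morphisms plane_rep plane_proj
  by (rule equivp_orbit_rel)

text \<open>The bracket \<open>(q / 2\<pi>) (\<partial>\<^sub>pf \<partial>\<^sub>qg - \<partial>\<^sub>qf \<partial>\<^sub>pg)\<close> on the plane.\<close>

definition plane_bracket ::
    "(real^2 \<Rightarrow> real) \<Rightarrow> (real^2 \<Rightarrow> real) \<Rightarrow> real^2 \<Rightarrow> real" where
  "plane_bracket f g w =
     w $ 2 / (2 * pi) * (partial 1 f w * partial 2 g w - partial 2 f w * partial 1 g w)"

text \<open>Functions on the quotient are represented by the corresponding functions on the plane.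
  Since members are continuous and invariant, they are automatically constant on the line
  \<open>q = 0\<close>.\<close>

definition C_quot :: "nat \<Rightarrow> (real^2 \<Rightarrow> real) bracket_alg" where
  "C_quot m = fun_alg
     {f. (\<forall>A\<in>G'. \<forall>w. f (A *v w) = f w) \<and> Cn_on m UNIV f \<and> smooth_on {w. w $ 2 \<noteq> 0} f}
     plane_bracket"


section \<open>The surface and the map onto it\<close>

text \<open>Coordinates: \<open>x = v $ 1\<close>, \<open>y = v $ 2\<close>, \<open>z = v $ 3\<close>. The index \<open>k\<close> stands for the
  singularity of type \<open>D\<close> with index \<open>2k + 1\<close>.\<close>

definition D_surf :: "nat \<Rightarrow> (real^3) set" where
  "D_surf k = {v. v $ 3 * (v $ 1)^2 + (v $ 2)^2 = (v $ 3)^(2 * k + 1)}"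

definition D_plus :: "nat \<Rightarrow> (real^3) set" where
  "D_plus k = (D_surf k \<inter> {v. v $ 3 > 0}) \<union> {0}"

definition phi :: "nat \<Rightarrow> real^2 \<Rightarrow> real^3" where
  "phi k w = (let p = w $ 1; q = w $ 2 in
     if q \<noteq> 0
     then vector [q^(2 * k) * cos (2 * pi * p / q), q^(2 * k + 1) * sin (2 * pi * p / q), q^2]
     else 0)"

lemma phi_cong_orbit:
  assumes "orbit_rel v w"
  shows "phi k v = phi k w"
proof (cases "v $ 2 = 0")
  case True
  then have "w $ 2 = 0" using assms unfolding orbit_rel_iff by auto
  with True show ?thesis by (simp add: phi_def)
next
  case q: False
  from assms show ?thesis
  proof (cases rule: orbit_rel_cases)
    case line
    with q show ?thesis by simp
  next
    case (plus n)
    have *: "2 * pi * (w $ 1) / w $ 2 = 2 * pi * (v $ 1) / v $ 2 + 2 * pi * of_int n"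
      using q plus by (simp add: field_simps)
    show ?thesis
      using q plus(2) unfolding phi_def Let_def *
      by (simp add: cos_add sin_add)
  next
    case (minus n)
    have *: "2 * pi * (w $ 1) / w $ 2 = - (2 * pi * (v $ 1) / v $ 2 + 2 * pi * of_int n)"
      using q minus by (simp add: field_simps)
    show ?thesis
      using q minus(2) unfolding phi_def Let_def * cos_minus sin_minus
      by (simp add: cos_add sin_add)
  qed
qed

lift_definition phi_bar :: "nat \<Rightarrow> plane_mod_G' \<Rightarrow> real^3" is phi
  by (rule phi_cong_orbit)

definition pullback :: "nat \<Rightarrow> (real^3 \<Rightarrow> real) \<Rightarrow> real^2 \<Rightarrow> real" where
  "pullback k F = F \<circ> phi_bar k \<circ> plane_proj"

definition A' :: "nat \<Rightarrow> (real^2 \<Rightarrow> real) bracket_alg" where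
  "A' k = fun_alg (gen_alg (range (\<lambda>i w. phi k w $ i))) plane_bracket"


section \<open>The Poisson structure on three-space\<close>

text \<open>The biderivation of smooth functions determined by \<open>{x,y} = x\<^sup>2 - (2k+1) z\<^sup>2\<^sup>k\<close>,
  \<open>{y,z} = 2zx\<close> and \<open>{z,x} = 2y\<close>.\<close>

definition space_bracket ::
    "nat \<Rightarrow> (real^3 \<Rightarrow> real) \<Rightarrow> (real^3 \<Rightarrow> real) \<Rightarrow> real^3 \<Rightarrow> real" where
  "space_bracket k F H v = (let x = v $ 1; y = v $ 2; z = v $ 3 in
     (x^2 - (2 * real k + 1) * z^(2 * k))
        * (partial 1 F v * partial 2 H v - partial 2 F v * partial 1 H v)
   + 2 * z * x * (partial 2 F v * partial 3 H v - partial 3 F v * partial 2 H v)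
   + 2 * y * (partial 3 F v * partial 1 H v - partial 1 F v * partial 3 H v))"

definition C_inf_space :: "nat \<Rightarrow> (real^3 \<Rightarrow> real) bracket_alg" where
  "C_inf_space k = fun_alg {F. smooth_on UNIV F} (space_bracket k)"

text \<open>The polynomial ring \<open>\<real>[x,y,z]\<close> is realised as the ring of polynomial functions on
  three-space, hence as a subalgebra of the smooth functions.\<close>

definition poly_space :: "nat \<Rightarrow> (real^3 \<Rightarrow> real) bracket_alg" where
  "poly_space k = fun_alg {F. real_polynomial_function F} (space_bracket k)"

definition casimir :: "nat \<Rightarrow> real^3 \<Rightarrow> real" where
  "casimir k v = v $ 3 * (v $ 1)^2 + (v $ 2)^2 - (v $ 3)^(2 * k + 1)"

definition casimir_ideal :: "nat \<Rightarrow> (real^3 \<Rightarrow> real) set" where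
  "casimir_ideal k = PIdl\<^bsub>poly_space k\<^esub> (casimir k)"

definition F_D :: "nat \<Rightarrow> (real^3 \<Rightarrow> real) set bracket_alg" where
  "F_D k = quot_alg (poly_space k) (casimir_ideal k)"

text \<open>The map induced by the pull-back on residue classes of polynomial functions.\<close>

definition pullback_quot :: "nat \<Rightarrow> (real^3 \<Rightarrow> real) set \<Rightarrow> real^2 \<Rightarrow> real" where
  "pullback_quot k X = the_elem (pullback k ` X)"

end

theory Submission
  imports Defs
begin

text \<open>The components of \<open>\<phi>\<^sub>k\<close> are of the form \<open>q\<^sup>a p\<^sup>b cos (2\<pi>p/q + c)\<close>. Differentiating such a
  function gives combinations of functions of the same form in which the exponent of \<open>q\<close> has dropped
  by at most two, so it is of class \<open>C\<^sup>n\<close> across the line \<open>q = 0\<close> as soon as \<open>a \<ge> 2n + 1\<close>. The chain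
  rule then gives the Poisson property off the line, and on the line both brackets vanish.

  For the isomorphism, a polynomial is reduced modulo the Casimir function to \<open>A(x,z) + y B(x,z)\<close>.
  If it vanishes on the image of \<open>\<phi>\<^sub>k\<close>, then, as that image contains both points \<open>(x,\<plusminus>y,z)\<close>
  whenever \<open>z > 0\<close> and \<open>\<bar>x\<bar> < z\<^sup>k\<close>, both \<open>A\<close> and \<open>B\<close> vanish on an open set and hence are zero.
  So the kernel of the pull-back on polynomials is generated by the Casimir function.\<close>

section \<open>Functions of class \<open>C\<^sup>n\<close>\<close>

text \<open>The set is open, so a derivative at one of its points sees only values inside it.
  Agreement therefore passes to derivatives of every order.\<close>

lemma Cn_on_cong:
  assumes "open S" "\<And>x. x \<in> S \<Longrightarrow> f x = g x"
  shows "Cn_on n S f \<longleftrightarrow> Cn_on n S g"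
proof -
  have "Cn_on n S g" if "Cn_on n S f" "\<And>x. x \<in> S \<Longrightarrow> f x = g x" for f g
    using that
  proof (induction n arbitrary: f g)
    case 0
    then show ?case by (simp cong: continuous_on_cong)
  next
    case (Suc n)
    have D: "(g has_derivative frechet_derivative f (at x)) (at x)" if "x \<in> S" for x
      using has_derivative_transform_within_open[OF _ assms(1) that, of f _ UNIV g]
        Suc.prems that by (simp add: frechet_derivative_works)
    have "Cn_on n S (\<lambda>x. frechet_derivative g (at x) v)" for v
    proof (rule Suc.IH)
      show "Cn_on n S (\<lambda>x. frechet_derivative f (at x) v)" using Suc.prems by simp
      show "frechet_derivative f (at x) v = frechet_derivative g (at x) v" if "x \<in> S" for x
        using frechet_derivative_at[OF D[OF that]] by simp
    qed
    with D show ?case by (auto simp: differentiable_def)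
  qed
  then show ?thesis using assms(2) by metis
qed

text \<open>Uniqueness of the derivative identifies \<open>D x\<close> with
  \<open>frechet_derivative\<close>, so that explicit derivative formulas can drive inductions on
  the order.\<close>

lemma Cn_on_SucI:
  assumes "open S" "\<And>x. x \<in> S \<Longrightarrow> (f has_derivative D x) (at x)"
    and "\<And>v. Cn_on n S (\<lambda>x. D x v)"
  shows "Cn_on (Suc n) S f"
proof -
  have "Cn_on n S (\<lambda>x. frechet_derivative f (at x) v)" for v
    using assms(3)[of v] Cn_on_cong[OF assms(1), of "\<lambda>x. D x v" "\<lambda>x. frechet_derivative f (at x) v"]
      frechet_derivative_at[OF assms(2)] by simp
  then show ?thesis using assms(2) by (auto simp: differentiable_def)
qed

lemma Cn_on_Suc_D:
  assumes "Cn_on (Suc n) S f"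
  shows "x \<in> S \<Longrightarrow> (f has_derivative frechet_derivative f (at x)) (at x)"
    and "Cn_on n S (\<lambda>x. frechet_derivative f (at x) v)"
  using assms by (auto simp: frechet_derivative_works)

text \<open>Only the base case has content: differentiability gives continuity. The rest is the
  induction hypothesis for the derivatives.\<close>

lemma Cn_on_SucD: "Cn_on (Suc n) S f \<Longrightarrow> Cn_on n S f"
proof (induction n arbitrary: f)
  case 0
  then show ?case
    by (auto intro!: continuous_at_imp_continuous_on differentiable_imp_continuous_within)
next
  case (Suc n)
  then show ?case by simp
qed

lemma Cn_on_const: "open S \<Longrightarrow> Cn_on n S (\<lambda>x. c)"
  by (induction n arbitrary: c) (auto intro: Cn_on_SucI[where D = "\<lambda>_ _. 0"] simp del: Cn_on.simps(2))

lemma Cn_on_add: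
  assumes "open S" "Cn_on n S f" "Cn_on n S g"
  shows "Cn_on n S (\<lambda>x. f x + g x)"
  using assms(2,3)
proof (induction n arbitrary: f g)
  case 0
  then show ?case by (auto intro: continuous_intros)
next
  case (Suc n)
  show ?case
    by (rule Cn_on_SucI[OF assms(1) has_derivative_add[OF Cn_on_Suc_D(1) Cn_on_Suc_D(1)]])
      (use Suc in \<open>auto simp del: Cn_on.simps(2) intro: Suc.IH Cn_on_Suc_D(2)\<close>)
qed

text \<open>The product rule keeps an undifferentiated factor of class \<open>Suc n\<close> in each
  term; \<open>Cn_on_SucD\<close> lowers it to class \<open>n\<close>.\<close>

lemma Cn_on_mult:
  assumes "open S" "Cn_on n S f" "Cn_on n S g"
  shows "Cn_on n S (\<lambda>x. f x * g x)"
  using assms(2,3)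
proof (induction n arbitrary: f g)
  case 0
  then show ?case by (auto intro: continuous_intros)
next
  case (Suc n)
  show ?case
    by (rule Cn_on_SucI[OF assms(1) has_derivative_mult[OF Cn_on_Suc_D(1) Cn_on_Suc_D(1)]])
      (use Suc in \<open>auto simp del: Cn_on.simps(2)
        intro!: Suc.IH Cn_on_add[OF assms(1)] intro: Cn_on_Suc_D(2) Cn_on_SucD\<close>)
qed

lemma Cn_on_sum:
  assumes "open S" "\<And>i. i \<in> I \<Longrightarrow> Cn_on n S (f i)"
  shows "Cn_on n S (\<lambda>x. \<Sum>i\<in>I. f i x)"
  using assms(2)
  by (induction I rule: infinite_finite_induct) (auto intro: Cn_on_const Cn_on_add assms(1))

section \<open>Composition with smooth functions\<close>

text \<open>The chain rule is put in terms of partial derivatives because a finite sum of products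
  is what the closure properties of \<open>Cn_on\<close> can handle.\<close>

lemma has_derivative_compose_vec:
  fixes F :: "real^'n \<Rightarrow> real"
  assumes F: "F differentiable (at (\<phi> x))"
    and \<phi>: "\<And>i. ((\<lambda>x. \<phi> x $ i) has_derivative D i) (at x)"
  shows "((\<lambda>x. F (\<phi> x)) has_derivative (\<lambda>v. \<Sum>i\<in>UNIV. partial i F (\<phi> x) * D i v)) (at x)"
proof -
  let ?L = "frechet_derivative F (at (\<phi> x))"
  have dF: "(F has_derivative ?L) (at (\<phi> x))" using F by (simp add: frechet_derivative_works)
  have "(\<phi> has_derivative (\<lambda>v. \<chi> i. D i v)) (at x)"
    by (subst has_derivative_componentwise_within)
      (auto simp: Basis_vec_def inner_axis \<phi>)
  from has_derivative_compose[OF this dF]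
  have 1: "((\<lambda>x. F (\<phi> x)) has_derivative (\<lambda>v. ?L (\<chi> i. D i v))) (at x)" .
  have "?L (\<chi> i. D i v) = (\<Sum>i\<in>UNIV. partial i F (\<phi> x) * D i v)" for v
  proof -
    have lin: "linear ?L" using dF by (rule has_derivative_linear)
    have "?L (\<chi> i. D i v) = ?L (\<Sum>i\<in>UNIV. D i v *\<^sub>R axis i 1)"
      by (rule arg_cong[of _ _ ?L]) (simp add: vec_eq_iff axis_def if_distrib cong: if_cong)
    also have "\<dots> = (\<Sum>i\<in>UNIV. D i v * ?L (axis i 1))"
      by (simp add: linear_sum[OF lin] linear_cmul[OF lin])
    finally show ?thesis by (simp add: partial_def mult.commute)
  qed
  with 1 show ?thesis by simp
qed

text \<open>Induction on the order with \<open>F\<close> arbitrary: the chain rule replaces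
  \<open>F\<close> by its partial derivatives, which are smooth again.\<close>

lemma Cn_on_compose:
  fixes F :: "real^'n \<Rightarrow> real"
  assumes S: "open S" and F: "smooth_on UNIV F" and \<phi>: "\<And>i. Cn_on n S (\<lambda>x. \<phi> x $ i)"
  shows "Cn_on n S (\<lambda>x. F (\<phi> x))"
  using F \<phi>
proof (induction n arbitrary: F)
  case 0
  have "continuous_on UNIV F" using 0(1) unfolding smooth_on_def by (metis Cn_on.simps(1))
  moreover have "continuous_on S \<phi>"
    using 0(2) continuous_on_componentwise[of S \<phi>]
    by (auto simp: Basis_vec_def inner_axis)
  ultimately show ?case using continuous_on_compose2[of UNIV F S \<phi>] by simp
next
  case (Suc n)
  have F_Suc: "Cn_on (Suc m) UNIV F" for m
    using Suc.prems(1) unfolding smooth_on_def by blast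
  have dF: "F differentiable (at y)" for y
    using F_Suc[of 0] by simp
  have sF: "smooth_on UNIV (partial i F)" for i
    unfolding smooth_on_def partial_def[abs_def] using Cn_on_Suc_D(2)[OF F_Suc] by blast
  show ?case
  proof (rule Cn_on_SucI[OF S has_derivative_compose_vec[OF dF]])
    show "((\<lambda>x. \<phi> x $ i) has_derivative frechet_derivative (\<lambda>x. \<phi> x $ i) (at x)) (at x)"
      if "x \<in> S" for x i
      using Cn_on_Suc_D(1)[OF Suc.prems(2) that] .
    show "Cn_on n S (\<lambda>x. \<Sum>i\<in>UNIV. partial i F (\<phi> x) * frechet_derivative (\<lambda>x. \<phi> x $ i) (at x) v)" for v
      by (rule Cn_on_sum[OF S], rule Cn_on_mult[OF S], rule Suc.IH[OF sF Cn_on_SucD[OF Suc.prems(2)]],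
          rule Cn_on_Suc_D(2)[OF Suc.prems(2)])
  qed
qed

section \<open>Smoothness of polynomial functions\<close>

lemma has_derivative_real_polynomial_function:
  assumes "real_polynomial_function f"
  obtains D where "\<And>x. (f has_derivative D x) (at x)" "\<And>v. real_polynomial_function (\<lambda>x. D x v)"
proof -
  have "\<exists>D. (\<forall>x. (f has_derivative D x) (at x)) \<and> (\<forall>v. real_polynomial_function (\<lambda>x. D x v))"
    using assms
  proof (induction f)
    case (linear f)
    then show ?case
      by (intro exI[of _ "\<lambda>_. f"])
        (auto intro: bounded_linear_imp_has_derivative real_polynomial_function.intros)
  next
    case (const c)
    then show ?case
      by (intro exI[of _ "\<lambda>_ _. 0"]) (auto intro: real_polynomial_function.intros)
  next
    case (add f g)
    then obtain D E where
      "\<And>x. (f has_derivative D x) (at x)" "\<And>v. real_polynomial_function (\<lambda>x. D x v)"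
      "\<And>x. (g has_derivative E x) (at x)" "\<And>v. real_polynomial_function (\<lambda>x. E x v)"
      by blast
    then show ?case
      by (intro exI[of _ "\<lambda>x v. D x v + E x v"])
        (auto intro: real_polynomial_function.intros has_derivative_add)
  next
    case (mult f g)
    then obtain D E where
      "\<And>x. (f has_derivative D x) (at x)" "\<And>v. real_polynomial_function (\<lambda>x. D x v)"
      "\<And>x. (g has_derivative E x) (at x)" "\<And>v. real_polynomial_function (\<lambda>x. E x v)"
      by blast
    then show ?case using mult.hyps
      by (intro exI[of _ "\<lambda>x v. f x * E x v + D x v * g x"] conjI allI has_derivative_mult
          real_polynomial_function.intros(3,4)) auto
  qed
  then show ?thesis using that by blast
qed

lemma smooth_on_real_polynomial_function:
  assumes "real_polynomial_function f" "open S"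
  shows "smooth_on S f"
proof -
  have "Cn_on n S f" for n
    using assms(1)
  proof (induction n arbitrary: f)
    case 0
    then show ?case
      by (auto intro!: continuous_at_imp_continuous_on differentiable_imp_continuous_within
          differentiable_at_real_polynomial_function)
  next
    case (Suc n)
    obtain D where "\<And>x. (f has_derivative D x) (at x)" "\<And>v. real_polynomial_function (\<lambda>x. D x v)"
      using has_derivative_real_polynomial_function[OF Suc.prems] by blast
    then show ?case by (intro Cn_on_SucI[OF assms(2)] Suc.IH)
  qed
  then show ?thesis by (simp add: smooth_on_def)
qed

lemma real_polynomial_function_partial:
  assumes "real_polynomial_function f"
  shows "real_polynomial_function (partial i f)"
proof -
  obtain D where D: "\<And>x. (f has_derivative D x) (at x)" "\<And>v. real_polynomial_function (\<lambda>x. D x v)"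
    using has_derivative_real_polynomial_function[OF assms] by blast
  show ?thesis
    using D(2)[of "axis i 1"] frechet_derivative_at[OF D(1)] by (simp add: partial_def[abs_def])
qed

section \<open>Regularity of the components of \<open>\<phi>\<^sub>k\<close>\<close>

lemma open_off_line: "open {w :: real^2. w $ 2 \<noteq> 0}"
  by (intro open_Collect_neq continuous_intros)

text \<open>The function \<open>q\<^sup>a p\<^sup>b cos (2\<pi>p/q + c)\<close>, extended by zero to the line \<open>q = 0\<close>. The phase \<open>c\<close>
  makes the family closed under differentiation.\<close>

definition trig_monom :: "int \<Rightarrow> nat \<Rightarrow> real \<Rightarrow> real^2 \<Rightarrow> real" where
  "trig_monom a b c w =
    (if w $ 2 = 0 then 0 else w $ 2 powi a * w $ 1 ^ b * cos (2 * pi * w $ 1 / w $ 2 + c))"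

text \<open>The phase shift by \<open>pi / 2\<close> stands for the minus sine. For
  \<open>b = 0\<close> the truncated exponent \<open>b - 1\<close> is harmless, since its
  coefficient is zero. The exponent of \<open>q\<close> is an integer because off the line it may
  become negative.\<close>

definition trig_monom_deriv :: "int \<Rightarrow> nat \<Rightarrow> real \<Rightarrow> real^2 \<Rightarrow> real^2 \<Rightarrow> real" where
  "trig_monom_deriv a b c w v =
     v $ 1 * (real b * trig_monom a (b - 1) c w + 2 * pi * trig_monom (a - 1) b (c + pi / 2) w)
   + v $ 2 * (real_of_int a * trig_monom (a - 1) b c w
       - 2 * pi * trig_monom (a - 2) (b + 1) (c + pi / 2) w)"

lemma powi_pred: "(q::real) \<noteq> 0 \<Longrightarrow> q powi (a - 1) = q powi a / q"
  "(q::real) \<noteq> 0 \<Longrightarrow> q powi (a - 2) = q powi a / (q * q)"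
  by (simp_all add: power_int_diff power2_eq_square)

lemma cos_shift: "cos (t + (c + pi / 2)) = - sin (t + c :: real)"
  by (simp add: add.assoc[symmetric] cos_add[of "t + c"])

lemma has_derivative_trig_monom_off_line:
  assumes "w $ 2 \<noteq> 0"
  shows "(trig_monom a b c has_derivative trig_monom_deriv a b c w) (at w)"
proof -
  have "((\<lambda>w :: real^2. w $ 2 powi a * w $ 1 ^ b * cos (2 * pi * w $ 1 / w $ 2 + c))
      has_derivative trig_monom_deriv a b c w) (at w)"
    unfolding trig_monom_deriv_def trig_monom_def cos_shift
    by (rule has_derivative_eq_rhs,
        (rule derivative_eq_intros refl assms bounded_linear_imp_has_derivative bounded_linear_vec_nth)+)
      (use assms in \<open>auto simp: fun_eq_iff powi_pred field_simps\<close>)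
  then show ?thesis
    by (rule has_derivative_transform_within_open[OF _ open_off_line])
      (use assms in \<open>auto simp: trig_monom_def\<close>)
qed

text \<open>On the line, the bound on the cosine leaves a positive power of \<open>q\<close> times a
  power of \<open>p\<close>, which tends to zero.\<close>

lemma isCont_trig_monom:
  assumes "w $ 2 \<noteq> 0 \<or> a \<ge> 1"
  shows "isCont (trig_monom a b c) w"
proof (cases "w $ 2 = 0")
  case False
  then show ?thesis
    by (rule has_derivative_continuous[OF has_derivative_trig_monom_off_line])
next
  case True
  with assms have a: "a \<ge> 1" by simp
  define n where "n = nat a"
  have n: "a = int n" "n \<ge> 1" using a by (auto simp: n_def)
  have "((\<lambda>x::real^2. \<bar>x $ 2\<bar> ^ n * \<bar>x $ 1\<bar> ^ b) \<longlongrightarrow> \<bar>w $ 2\<bar> ^ n * \<bar>w $ 1\<bar> ^ b) (at w)"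
    by (intro tendsto_intros)
  then have "((\<lambda>x::real^2. \<bar>x $ 2\<bar> ^ n * \<bar>x $ 1\<bar> ^ b) \<longlongrightarrow> 0) (at w)"
    using True n by (simp add: power_0_left)
  moreover have le: "norm (trig_monom a b c x) \<le> \<bar>x $ 2\<bar> ^ n * \<bar>x $ 1\<bar> ^ b" for x
    using mult_left_mono[OF abs_cos_le_one, of "\<bar>x $ 2\<bar> ^ n * \<bar>x $ 1\<bar> ^ b" "2 * pi * x $ 1 / x $ 2 + c"]
    by (auto simp: trig_monom_def n abs_mult power_abs)
  ultimately have "(trig_monom a b c \<longlongrightarrow> 0) (at w)"
    by (intro Lim_null_comparison[OF always_eventually, of "trig_monom a b c"] allI)
  then show ?thesis using True by (simp add: isCont_def trig_monom_def)
qed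

text \<open>On the line the candidate derivative is zero. Splitting off one factor \<open>q\<close>,
  bounded by the distance to \<open>w\<close>, bounds the difference quotient by the monomial with
  exponent \<open>a - 1\<close>, which is continuous and vanishes at \<open>w\<close>.\<close>

lemma has_derivative_trig_monom:
  assumes "w $ 2 \<noteq> 0 \<or> a \<ge> 2"
  shows "(trig_monom a b c has_derivative trig_monom_deriv a b c w) (at w)"
proof (cases "w $ 2 = 0")
  case False
  then show ?thesis by (rule has_derivative_trig_monom_off_line)
next
  case True
  with assms have a: "a \<ge> 2" by simp
  have 0: "trig_monom_deriv a b c w = (\<lambda>_. 0)"
    using True by (simp add: trig_monom_deriv_def trig_monom_def fun_eq_iff)
  have "((\<lambda>x. \<bar>trig_monom (a - 1) b c x\<bar>) \<longlongrightarrow> \<bar>trig_monom (a - 1) b c w\<bar>) (at w)"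
    using isCont_trig_monom[of w "a - 1" b c] a by (intro tendsto_rabs) (simp add: isCont_def)
  then have lim: "((\<lambda>x. \<bar>trig_monom (a - 1) b c x\<bar>) \<longlongrightarrow> 0) (at w)"
    using True by (simp add: trig_monom_def)
  have le: "norm ((trig_monom a b c x - trig_monom a b c w - 0) /\<^sub>R norm (x - w))
      \<le> \<bar>trig_monom (a - 1) b c x\<bar>" for x
  proof -
    have eq: "trig_monom a b c x = x $ 2 * trig_monom (a - 1) b c x"
      by (simp add: trig_monom_def powi_pred)
    have "\<bar>x $ 2\<bar> \<le> norm (x - w)"
      using component_le_norm_cart[of "x - w" 2] True by simp
    then have "\<bar>x $ 2\<bar> * \<bar>trig_monom (a - 1) b c x\<bar> \<le> norm (x - w) * \<bar>trig_monom (a - 1) b c x\<bar>"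
      by (intro mult_right_mono) auto
    then have "\<bar>trig_monom a b c x\<bar> \<le> norm (x - w) * \<bar>trig_monom (a - 1) b c x\<bar>"
      by (simp add: eq abs_mult)
    then show ?thesis
      using True by (cases "x = w") (auto simp: trig_monom_def[of a b c w] divide_simps mult.commute)
  qed
  show ?thesis
    unfolding 0 has_derivative_def
    by (intro conjI bounded_linear_zero Lim_null_comparison[OF always_eventually lim] allI)
      (use le in \<open>simp add: divide_inverse mult.commute\<close>)
qed

text \<open>A derivative lowers the exponent of \<open>q\<close> by at most two, and continuity needs exponent
  at least one.\<close>

lemma Cn_on_trig_monom:
  assumes "open S" "S \<subseteq> {w. w $ 2 \<noteq> 0} \<or> a \<ge> 2 * int n + 1"
  shows "Cn_on n S (trig_monom a b c)"
  using assms(2)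
proof (induction n arbitrary: a b c)
  case 0
  then show ?case
    by (auto intro!: continuous_at_imp_continuous_on isCont_trig_monom)
next
  case (Suc n)
  show ?case
  proof (rule Cn_on_SucI[OF assms(1)])
    show "(trig_monom a b c has_derivative trig_monom_deriv a b c w) (at w)" if "w \<in> S" for w
      using Suc.prems that by (intro has_derivative_trig_monom) auto
    have T: "Cn_on n S (\<lambda>x. trig_monom a' b' c' x)" if "a' \<ge> a - 2" for a' b' c'
      using Suc.prems that by (intro Suc.IH) auto
    show "Cn_on n S (\<lambda>w. trig_monom_deriv a b c w v)" for v
      \<comment> \<open>The difference becomes a sum with a negative constant coefficient, so
        closure under sums and products suffices.\<close>
      unfolding trig_monom_deriv_def diff_conv_add_uminus minus_mult_left
      by (intro Cn_on_add Cn_on_mult Cn_on_const assms(1) T) auto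
  qed
qed

section \<open>The map \<open>phi\<close> and its components\<close>

text \<open>The phase \<open>- pi / 2\<close> turns the cosine into the sine of the second
  component.\<close>

lemma phi_nth:
  "phi k w $ 1 = trig_monom (2 * int k) 0 0 w"
  "phi k w $ 2 = trig_monom (2 * int k + 1) 0 (- pi / 2) w"
  "phi k w $ 3 = (w $ 2)\<^sup>2"
proof -
  have "q ^ (2 * k) = q powi (2 * int k)" "q ^ (2 * k + 1) = q powi (2 * int k + 1)" for q :: real
    using power_int_of_nat[of q "2 * k"] power_int_of_nat[of q "2 * k + 1"]
    by (simp_all add: add.commute)
  then show "phi k w $ 1 = trig_monom (2 * int k) 0 0 w"
    "phi k w $ 2 = trig_monom (2 * int k + 1) 0 (- pi / 2) w"
    "phi k w $ 3 = (w $ 2)\<^sup>2"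
    by (auto simp: phi_def Let_def trig_monom_def cos_diff)
qed

lemma phi_off_line:
  assumes "w $ 2 \<noteq> 0"
  shows "phi k w $ 1 = (w $ 2) ^ (2 * k) * cos (2 * pi * w $ 1 / w $ 2)"
    "phi k w $ 2 = (w $ 2) ^ (2 * k + 1) * sin (2 * pi * w $ 1 / w $ 2)"
    "phi k w $ 3 = (w $ 2)\<^sup>2"
  using assms by (auto simp: phi_def Let_def)

lemma phi_line: "w $ 2 = 0 \<Longrightarrow> phi k w = 0"
  by (simp add: phi_def)

lemma pullback_apply [simp]: "pullback k F w = F (phi k w)"
  by (simp add: pullback_def phi_bar.abs_eq)

lemma phi_casimir: "casimir k (phi k w) = 0"
proof (cases "w $ 2 = 0")
  case True
  then show ?thesis by (simp add: phi_line casimir_def)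
next
  case False
  define q r c s where "q = w $ 2" and "r = (w $ 2) ^ (2 * k)"
    and "c = cos (2 * pi * w $ 1 / w $ 2)" and "s = sin (2 * pi * w $ 1 / w $ 2)"
  have "casimir k (phi k w) = q\<^sup>2 * (r * c)\<^sup>2 + (q * r * s)\<^sup>2 - q\<^sup>2 * r\<^sup>2"
    unfolding casimir_def phi_off_line[OF False] q_def r_def c_def s_def
    by (simp add: power2_eq_square power_mult_distrib)
  also have "\<dots> = q\<^sup>2 * r\<^sup>2 * (c\<^sup>2 + s\<^sup>2 - 1)" by (simp add: algebra_simps power_mult_distrib)
  finally show ?thesis by (simp add: c_def s_def)
qed

lemma phi_in_D_plus: "phi k w \<in> D_plus k"
proof (cases "w $ 2 = 0")
  case True
  then show ?thesis by (simp add: phi_line D_plus_def)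
next
  case False
  then show ?thesis
    using phi_casimir[of k w] by (simp add: D_plus_def D_surf_def casimir_def phi_off_line)
qed

text \<open>The smallest exponent of \<open>q\<close> in the trigonometric components is
  \<open>2 * k\<close>, and \<open>2 * k \<ge> 2 * n + 1\<close> amounts to
  \<open>n < k\<close>.\<close>

lemma Cn_on_phi_nth:
  assumes "open S" "S \<subseteq> {w. w $ 2 \<noteq> 0} \<or> n < k"
  shows "Cn_on n S (\<lambda>w. phi k w $ i)"
proof -
  have "real_polynomial_function (\<lambda>w :: real^2. (w $ 2)\<^sup>2)"
    by (intro real_polynomial_function_power real_polynomial_function.intros bounded_linear_vec_nth)
  from smooth_on_real_polynomial_function[OF this assms(1)]
  have "Cn_on n S (\<lambda>w. phi k w $ 3)" by (simp add: phi_nth smooth_on_def)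
  moreover have "Cn_on n S (\<lambda>w. phi k w $ 1)"
    unfolding phi_nth by (rule Cn_on_trig_monom) (use assms in auto)
  moreover have "Cn_on n S (\<lambda>w. phi k w $ 2)"
    unfolding phi_nth by (rule Cn_on_trig_monom) (use assms in auto)
  ultimately show ?thesis using exhaust_3[of i] by auto
qed

lemma phi_G'_invariant:
  assumes "A \<in> G'"
  shows "phi k (A *v w) = phi k w"
  using assms phi_cong_orbit[of w "A *v w"] unfolding orbit_rel_def by metis

section \<open>The pull-back is a Poisson morphism\<close>

text \<open>In contrast to \<open>trig_monom_deriv\<close>, natural powers and a common angle
  \<open>t\<close> are used, so that computing brackets becomes plain algebra. The last branch is
  the index 3.\<close>

definition phi_deriv :: "nat \<Rightarrow> 3 \<Rightarrow> real^2 \<Rightarrow> real^2 \<Rightarrow> real" where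
  "phi_deriv k i w v = (let p = w $ 1; q = w $ 2; t = 2 * pi * p / q in
     if i = 1 then v $ 1 * (- 2 * pi * q ^ (2 * k) * sin t / q)
         + v $ 2 * (2 * real k * q ^ (2 * k) * cos t / q + q ^ (2 * k) * t * sin t / q)
     else if i = 2 then v $ 1 * (2 * pi * q ^ (2 * k) * cos t)
         + v $ 2 * ((2 * real k + 1) * q ^ (2 * k) * sin t - q ^ (2 * k) * t * cos t)
     else v $ 2 * (2 * q))"

lemma has_derivative_phi_nth:
  assumes "w $ 2 \<noteq> 0"
  shows "((\<lambda>w. phi k w $ i) has_derivative phi_deriv k i w) (at w)"
proof -
  \<comment> \<open>Recombines the truncated exponent from differentiating the power of
    \<open>q\<close>; at \<open>k = 0\<close> that term has coefficient zero.\<close>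
  have pw: "q * q ^ (k * 2 - Suc 0) = q ^ (k * 2)" if "k > 0" for q :: real
    using that by (simp flip: power_Suc)
  have "((\<lambda>w. phi k w $ 1) has_derivative phi_deriv k 1 w) (at w)"
    by (rule has_derivative_transform_within_open[OF _ open_off_line, where
            f = "\<lambda>w. (w $ 2) ^ (2 * k) * cos (2 * pi * w $ 1 / w $ 2)"],
        rule has_derivative_eq_rhs,
        (rule derivative_eq_intros refl assms bounded_linear_imp_has_derivative bounded_linear_vec_nth)+)
      (use assms in \<open>auto simp: fun_eq_iff phi_deriv_def Let_def field_simps pw phi_off_line\<close>)
  moreover have "((\<lambda>w. phi k w $ 2) has_derivative phi_deriv k 2 w) (at w)"
    by (rule has_derivative_transform_within_open[OF _ open_off_line, where
            f = "\<lambda>w. (w $ 2) ^ (2 * k + 1) * sin (2 * pi * w $ 1 / w $ 2)"],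
        rule has_derivative_eq_rhs,
        (rule derivative_eq_intros refl assms bounded_linear_imp_has_derivative bounded_linear_vec_nth)+)
      (use assms in \<open>auto simp: fun_eq_iff phi_deriv_def Let_def field_simps phi_off_line\<close>)
  moreover have "((\<lambda>w. phi k w $ 3) has_derivative phi_deriv k 3 w) (at w)"
    unfolding phi_nth
    by (rule has_derivative_eq_rhs,
        (rule derivative_eq_intros refl bounded_linear_imp_has_derivative bounded_linear_vec_nth)+)
      (auto simp: fun_eq_iff phi_deriv_def Let_def)
  ultimately show ?thesis using exhaust_3[of i] by auto
qed

lemma partial_pullback:
  assumes "w $ 2 \<noteq> 0" "F differentiable (at (phi k w))"
  shows "partial j (pullback k F) w =
    (\<Sum>i\<in>UNIV. partial i F (phi k w) * phi_deriv k i w (axis j 1))"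
proof -
  have "pullback k F = (\<lambda>w. F (phi k w))" by (simp add: fun_eq_iff)
  then have "partial j (pullback k F) w = frechet_derivative (\<lambda>w. F (phi k w)) (at w) (axis j 1)"
    by (simp add: partial_def)
  then show ?thesis
    unfolding frechet_derivative_at[OF has_derivative_compose_vec[OF assms(2)
          has_derivative_phi_nth[OF assms(1)]], symmetric] .
qed

text \<open>Off the line, the chain rule reduces the claim to the brackets of the three components.
  On the line, the plane bracket carries the factor \<open>q = 0\<close>, and for
  \<open>k > 0\<close> all coefficients of the space bracket vanish at the origin.\<close>

lemma pullback_space_bracket:
  assumes F: "\<And>v. F differentiable (at v)" and H: "\<And>v. H differentiable (at v)" and k: "k > 0"
  shows "plane_bracket (pullback k F) (pullback k H) = pullback k (space_bracket k F H)"
proof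
  fix w :: "real^2"
  show "plane_bracket (pullback k F) (pullback k H) w = pullback k (space_bracket k F H) w"
  proof (cases "w $ 2 = 0")
    case True
    then show ?thesis using k
      by (simp add: plane_bracket_def space_bracket_def phi_line Let_def)
  next
    case False
    define t q Q where "t = 2 * pi * w $ 1 / w $ 2" and "q = w $ 2" and "Q = (w $ 2) ^ (2 * k)"
    define s c where "s = sin t" and "c = cos t"
    have q: "q \<noteq> 0" using False by (simp add: q_def)
    have phi: "phi k w $ 1 = Q * c" "phi k w $ 2 = q * Q * s" "phi k w $ 3 = q\<^sup>2"
      "(q\<^sup>2) ^ (2 * k) = Q\<^sup>2"
      using phi_off_line[OF False]
      by (simp_all add: Q_def c_def s_def t_def q_def mult.commute flip: power_mult)
    have sc: "s\<^sup>2 = 1 - c\<^sup>2" by (simp add: s_def c_def sin_squared_eq)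
    have d:
      "phi_deriv k 1 w (axis 1 1) = - 2 * pi * Q * s / q"
      "phi_deriv k 1 w (axis 2 1) = 2 * real k * Q * c / q + Q * t * s / q"
      "phi_deriv k 2 w (axis 1 1) = 2 * pi * Q * c"
      "phi_deriv k 2 w (axis 2 1) = (2 * real k + 1) * Q * s - Q * t * c"
      "phi_deriv k 3 w (axis 1 1) = 0"
      "phi_deriv k 3 w (axis 2 1) = 2 * q"
      by (simp_all add: phi_deriv_def Let_def axis_def t_def q_def Q_def s_def c_def)
    \<comment> \<open>This is the bracket of the first two components. The terms containing
      \<open>t\<close> cancel, and \<open>sc\<close> then gives \<open>x^2 - (2k+1) z^(2k)\<close>
      with \<open>x = Q * c\<close> and \<open>z^(2k) = Q^2\<close>.\<close>
    have b12: "q / (2 * pi) * (- 2 * pi * Q * s / q * ((2 * real k + 1) * Q * s - Q * t * c)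
       - (2 * real k * Q * c / q + Q * t * s / q) * (2 * pi * Q * c)) =
      (Q * c)\<^sup>2 - (2 * real k + 1) * Q\<^sup>2"
    proof -
      have "q / (2 * pi) * (- 2 * pi * Q * s / q * ((2 * real k + 1) * Q * s - Q * t * c)
         - (2 * real k * Q * c / q + Q * t * s / q) * (2 * pi * Q * c))
        = - (2 * real k + 1) * Q\<^sup>2 * s\<^sup>2 - 2 * real k * Q\<^sup>2 * c\<^sup>2"
        using q by (simp add: field_simps power2_eq_square)
      then show ?thesis by (simp add: sc algebra_simps)
    qed
    define F1 F2 F3 H1 H2 H3 where
      "F1 = partial 1 F (phi k w)" and "F2 = partial 2 F (phi k w)" and "F3 = partial 3 F (phi k w)"
      and "H1 = partial 1 H (phi k w)" and "H2 = partial 2 H (phi k w)" and "H3 = partial 3 H (phi k w)"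
    note defs = this
    \<comment> \<open>The coefficients \<open>2zx\<close> and \<open>2y\<close> come out at once
      because the third component depends on \<open>q\<close> alone; the remaining one is left in
      the shape of \<open>b12\<close>.\<close>
    have "plane_bracket (pullback k F) (pullback k H) w =
      q / (2 * pi) * (- 2 * pi * Q * s / q * ((2 * real k + 1) * Q * s - Q * t * c)
       - (2 * real k * Q * c / q + Q * t * s / q) * (2 * pi * Q * c)) * (F1 * H2 - F2 * H1)
      + 2 * q\<^sup>2 * (Q * c) * (F2 * H3 - F3 * H2) + 2 * (q * Q * s) * (F3 * H1 - F1 * H3)"
      unfolding plane_bracket_def partial_pullback[OF False F] partial_pullback[OF False H] sum_3 d
        defs[symmetric] q_def[symmetric]
      using q by (simp add: field_simps power2_eq_square)
    also have "\<dots> = pullback k (space_bracket k F H) w"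
      unfolding b12 by (simp add: space_bracket_def Let_def phi defs)
    finally show ?thesis .
  qed
qed

lemma smooth_on_UNIV_differentiable:
  assumes "smooth_on UNIV F"
  shows "F differentiable (at v)"
proof -
  have "Cn_on (Suc 0) UNIV F" using assms unfolding smooth_on_def by blast
  then show ?thesis by simp
qed

lemma pullback_in_C_quot:
  assumes "smooth_on UNIV F" "m < k"
  shows "pullback k F \<in> carrier (C_quot m)"
proof -
  have "Cn_on m UNIV (\<lambda>w. F (phi k w))"
    by (rule Cn_on_compose[OF open_UNIV assms(1) Cn_on_phi_nth]) (use assms in auto)
  moreover have "smooth_on {w. w $ 2 \<noteq> 0} (\<lambda>w. F (phi k w))"
    unfolding smooth_on_def
    by (intro allI Cn_on_compose[OF open_off_line assms(1) Cn_on_phi_nth] open_off_line) auto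
  ultimately show ?thesis
    by (simp add: C_quot_def fun_alg_def phi_G'_invariant pullback_apply[abs_def])
qed

lemma pullback_poisson_hom:
  assumes "m < k"
  shows "pullback k \<in> poisson_hom (C_inf_space k) (C_quot m)"
proof -
  have "pullback k \<in> ring_hom (C_inf_space k) (C_quot m)"
    using pullback_in_C_quot[OF _ assms]
    by (intro ring_hom_memI) (simp_all add: C_inf_space_def C_quot_def fun_alg_def fun_eq_iff)
  moreover have "pullback k (space_bracket k F H) = plane_bracket (pullback k F) (pullback k H)"
    if "smooth_on UNIV F" "smooth_on UNIV H" for F H
    using that assms by (intro pullback_space_bracket[symmetric] smooth_on_UNIV_differentiable) auto
  ultimately show ?thesis
    by (simp add: poisson_hom_def alg_hom_def C_inf_space_def C_quot_def fun_alg_def fun_eq_iff)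
qed

section \<open>The kernel on polynomials\<close>

text \<open>With \<open>q = sqrt z\<close>, dividing the equation of the surface by
  \<open>q^(4k+2)\<close> gives the unit circle, which supplies an angle \<open>t\<close>.\<close>

lemma D_surf_pos_in_range_phi:
  assumes "v \<in> D_surf k" "v $ 3 > 0"
  shows "v \<in> range (phi k)"
proof -
  define q where "q = sqrt (v $ 3)"
  have q: "q > 0" "v $ 3 = q\<^sup>2" using assms(2) by (auto simp: q_def)
  have "(v $ 1 / q ^ (2 * k))\<^sup>2 + (v $ 2 / q ^ (2 * k + 1))\<^sup>2 = 1"
  proof -
    have "q\<^sup>2 * (v $ 1)\<^sup>2 + (v $ 2)\<^sup>2 = (q ^ (2 * k + 1))\<^sup>2"
      using assms(1) unfolding D_surf_def by (simp add: q power_mult_distrib mult.commute flip: power_mult)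
    with q show ?thesis by (simp add: field_simps power_mult_distrib)
  qed
  then obtain t where t: "v $ 1 / q ^ (2 * k) = cos t" "v $ 2 / q ^ (2 * k + 1) = sin t"
    using sincos_total_2pi by metis
  \<comment> \<open>The first coordinate is chosen so that
    \<open>2 * pi * p / q = t\<close>.\<close>
  let ?w = "vector [q * t / (2 * pi), q] :: real^2"
  have "v = phi k ?w"
    using q t by (simp add: vec_eq_iff forall_3 phi_off_line field_simps)
  then show ?thesis by blast
qed

text \<open>Reduction modulo the Casimir function to degree at most one in \<open>y\<close>: the remainder is
  \<open>A(x,z) + y B(x,z)\<close>.\<close>

definition casimir_normal_form ::
    "nat \<Rightarrow> (real^3 \<Rightarrow> real) \<Rightarrow> (real^3 \<Rightarrow> real) \<Rightarrow> (real^3 \<Rightarrow> real) \<Rightarrow> (real^3 \<Rightarrow> real) \<Rightarrow> bool" where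
  "casimir_normal_form k P C A B \<longleftrightarrow>
    real_polynomial_function C \<and> real_polynomial_function A \<and> real_polynomial_function B \<and>
    (\<forall>v w. v $ 1 = w $ 1 \<longrightarrow> v $ 3 = w $ 3 \<longrightarrow> A v = A w \<and> B v = B w) \<and>
    (\<forall>v. P v = C v * casimir k v + A v + v $ 2 * B v)"

lemma linear_coordinates3:
  fixes h :: "real^3 \<Rightarrow> real"
  assumes "linear h"
  shows "h v = v $ 1 * h (axis 1 1) + v $ 2 * h (axis 2 1) + v $ 3 * h (axis 3 1)"
proof -
  have "v = v $ 1 *\<^sub>R axis 1 1 + v $ 2 *\<^sub>R axis 2 1 + v $ 3 *\<^sub>R axis 3 1"
    by (simp add: vec_eq_iff forall_3 axis_def)
  from arg_cong[OF this, of h] show ?thesis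
    by (simp add: linear_add[OF assms] linear_cmul[OF assms])
qed

lemma real_polynomial_function_nth: "real_polynomial_function (\<lambda>v :: real^'n. v $ i)"
  by (rule real_polynomial_function.intros(1)[OF bounded_linear_vec_nth])

lemma real_polynomial_function_casimir: "real_polynomial_function (casimir k)"
  unfolding casimir_def[abs_def]
  by (intro real_polynomial_function.intros(3,4) real_polynomial_function_diff
      real_polynomial_function_power real_polynomial_function_nth)

text \<open>Only products create a square of \<open>y\<close>. It is traded for the Casimir function
  plus a polynomial in \<open>x\<close> and \<open>z\<close>, so degree one in \<open>y\<close> is
  preserved.\<close>

lemma casimir_normal_form_exists:
  assumes "real_polynomial_function P"
  shows "\<exists>C A B. casimir_normal_form k P C A B"
  using assms
proof (induction P)
  case (linear f)
  define a b c where "a = f (axis 1 1)" and "b = f (axis 2 1)" and "c = f (axis 3 1)"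
  have "f v = a * v $ 1 + c * v $ 3 + v $ 2 * b" for v
    using linear_coordinates3[OF bounded_linear.linear[OF linear], of v]
    by (simp add: a_def b_def c_def algebra_simps)
  moreover have "real_polynomial_function (\<lambda>v :: real^3. a * v $ 1 + c * v $ 3)"
    by (intro real_polynomial_function.intros bounded_linear_const_mult bounded_linear_vec_nth)
  ultimately show ?case
    unfolding casimir_normal_form_def
    by (intro exI[of _ "\<lambda>_. 0"] exI[of _ "\<lambda>v. a * v $ 1 + c * v $ 3"]
        exI[of _ "\<lambda>_. b"]) (simp add: real_polynomial_function.intros(2))
next
  case (const c)
  then show ?case
    unfolding casimir_normal_form_def
    by (intro exI[of _ "\<lambda>_. 0"] exI[of _ "\<lambda>_. c"]) (simp add: real_polynomial_function.intros(2))
next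
  case (add f g)
  then obtain C A B C' A' B'
    where "casimir_normal_form k f C A B" "casimir_normal_form k g C' A' B'"
    by blast
  note nf = this[unfolded casimir_normal_form_def]
  have "casimir_normal_form k (\<lambda>v. f v + g v) (\<lambda>v. C v + C' v) (\<lambda>v. A v + A' v) (\<lambda>v. B v + B' v)"
    unfolding casimir_normal_form_def
  proof (intro conjI allI)
    show "f v + g v = (C v + C' v) * casimir k v + (A v + A' v) + v $ 2 * (B v + B' v)" for v
    proof -
      have "f v = C v * casimir k v + A v + v $ 2 * B v" "g v = C' v * casimir k v + A' v + v $ 2 * B' v"
        using nf by blast+
      then show ?thesis by (simp add: algebra_simps)
    qed
    show "v $ 1 = w $ 1 \<longrightarrow> v $ 3 = w $ 3 \<longrightarrow> A v + A' v = A w + A' w \<and> B v + B' v = B w + B' w" for v w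
      using nf by metis
  qed (rule real_polynomial_function.intros(3); use nf in blast)+
  then show ?case by blast
next
  case (mult f g)
  then obtain C A B C' A' B'
    where "casimir_normal_form k f C A B" "casimir_normal_form k g C' A' B'"
    by blast
  note nf = this[unfolded casimir_normal_form_def]
  then have f: "f v = C v * casimir k v + A v + v $ 2 * B v"
    and g: "g v = C' v * casimir k v + A' v + v $ 2 * B' v" for v
    by blast+
  \<comment> \<open>\<open>K\<close> is the value of \<open>y^2\<close> on the surface, and it is
    free of \<open>y\<close>.\<close>
  define K where "K v = v $ 3 ^ (2 * k + 1) - v $ 3 * (v $ 1)\<^sup>2" for v :: "real^3"
  have K: "real_polynomial_function K"
    unfolding K_def by (intro real_polynomial_function_diff real_polynomial_function_power
        real_polynomial_function.intros(4) real_polynomial_function_nth)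
  have y2: "(v $ 2)\<^sup>2 = casimir k v + K v" for v
    by (simp add: casimir_def K_def)
  have "f v * g v = (C v * C' v * casimir k v + C v * (A' v + v $ 2 * B' v) + (A v + v $ 2 * B v) * C' v
      + B v * B' v) * casimir k v + (A v * A' v + K v * (B v * B' v)) + v $ 2 * (A v * B' v + B v * A' v)" for v
  proof -
    have "f v * g v = (C v * C' v * casimir k v + C v * (A' v + v $ 2 * B' v)
        + (A v + v $ 2 * B v) * C' v) * casimir k v + A v * A' v + (v $ 2)\<^sup>2 * (B v * B' v)
        + v $ 2 * (A v * B' v + B v * A' v)"
      unfolding f g by (simp add: algebra_simps power2_eq_square)
    then show ?thesis unfolding y2 by (simp add: algebra_simps)
  qed
  moreover have "v $ 1 = w $ 1 \<longrightarrow> v $ 3 = w $ 3 \<longrightarrow>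
      A v * A' v + K v * (B v * B' v) = A w * A' w + K w * (B w * B' w) \<and>
      A v * B' v + B v * A' v = A w * B' w + B w * A' w" for v w
    using nf unfolding K_def by metis
  moreover have polys: "real_polynomial_function C" "real_polynomial_function A" "real_polynomial_function B"
    "real_polynomial_function C'" "real_polynomial_function A'" "real_polynomial_function B'"
    using nf by blast+
  ultimately have "casimir_normal_form k (\<lambda>v. f v * g v)
      (\<lambda>v. C v * C' v * casimir k v + C v * (A' v + v $ 2 * B' v) + (A v + v $ 2 * B v) * C' v + B v * B' v)
      (\<lambda>v. A v * A' v + K v * (B v * B' v)) (\<lambda>v. A v * B' v + B v * A' v)"
    unfolding casimir_normal_form_def
    by (intro conjI allI real_polynomial_function.intros(3,4) K real_polynomial_function_casimir
        real_polynomial_function_nth polys)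
  then show ?case by blast
qed

section \<open>Polynomials vanishing on an open set\<close>

lemma real_polynomial_function_infinite_zeros:
  fixes f :: "real \<Rightarrow> real"
  assumes "real_polynomial_function f" "infinite S" "\<And>x. x \<in> S \<Longrightarrow> f x = 0"
  shows "f x = 0"
proof -
  obtain a n where f: "f = (\<lambda>x. \<Sum>i\<le>n. a i * x ^ i)"
    using assms(1) unfolding real_polynomial_function_iff_sum by blast
  have "infinite {x. (\<Sum>i\<le>n. a i * x ^ i) = 0}"
    using assms(2,3) finite_subset[of S "{x. (\<Sum>i\<le>n. a i * x ^ i) = 0}"] by (auto simp: f)
  then show ?thesis unfolding polyfun_finite_roots by (simp add: f)
qed

lemma real_polynomial_function_line:
  fixes P :: "real^3 \<Rightarrow> real"
  assumes "real_polynomial_function P"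
  shows "real_polynomial_function (\<lambda>t. P (u + t *\<^sub>R v))"
proof -
  have "polynomial_function (\<lambda>t. u + t *\<^sub>R v)"
    by (intro polynomial_function_add polynomial_function_const polynomial_function_bounded_linear
        bounded_linear_scaleR_left)
  from real_polynomial_function_compose[OF this assms] show ?thesis by (simp add: o_def)
qed

text \<open>One variable at a time: for fixed \<open>z > 0\<close> the zeros fill an interval in the
  \<open>x\<close> direction, and then the zeros fill a half-line in the \<open>z\<close>
  direction.\<close>

lemma no_middle_variable_zero:
  fixes P :: "real^3 \<Rightarrow> real"
  assumes P: "real_polynomial_function P"
    and indep: "\<And>v w. v $ 1 = w $ 1 \<Longrightarrow> v $ 3 = w $ 3 \<Longrightarrow> P v = P w"
    and zero: "\<And>v. v $ 3 > 0 \<Longrightarrow> \<bar>v $ 1\<bar> < (v $ 3) ^ k \<Longrightarrow> P v = 0"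
  shows "P v = 0"
proof -
  have pos: "P v = 0" if z: "v $ 3 > 0" for v
  proof -
    define u b where "u = v - (v $ 1) *\<^sub>R axis 1 1" and "b = (v $ 3) ^ k"
    have "P (u + t *\<^sub>R axis 1 1) = 0" for t
    proof (rule real_polynomial_function_infinite_zeros[OF real_polynomial_function_line[OF P]])
      show "infinite {- b<..<b}" using z by (simp add: infinite_Ioo b_def)
      show "P (u + t *\<^sub>R axis 1 1) = 0" if "t \<in> {- b<..<b}" for t
        by (rule zero) (use that z in \<open>auto simp: u_def b_def axis_def\<close>)
    qed
    from this[of "v $ 1"] show ?thesis by (simp add: u_def)
  qed
  define u where "u = v - (v $ 3) *\<^sub>R axis 3 1"
  have "P (u + t *\<^sub>R axis 3 1) = 0" for t
  proof (rule real_polynomial_function_infinite_zeros[OF real_polynomial_function_line[OF P]])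
    show "infinite {0 :: real <..}" by (rule infinite_Ioi)
    show "P (u + t *\<^sub>R axis 3 1) = 0" if "t \<in> {0 <..}" for t
      by (rule pos) (use that in \<open>auto simp: u_def axis_def\<close>)
  qed
  from this[of "v $ 3"] show ?thesis by (simp add: u_def)
qed

lemma phi_kernel:
  assumes P: "real_polynomial_function P" and zero: "\<And>w. P (phi k w) = 0"
  obtains C where "real_polynomial_function C" "P = (\<lambda>v. C v * casimir k v)"
proof -
  obtain C A B where
    *: "real_polynomial_function C" "real_polynomial_function A" "real_polynomial_function B"
    and indep: "\<And>v w. v $ 1 = w $ 1 \<Longrightarrow> v $ 3 = w $ 3 \<Longrightarrow> A v = A w \<and> B v = B w"
    and P_eq: "\<And>v. P v = C v * casimir k v + A v + v $ 2 * B v"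
    using casimir_normal_form_exists[OF P, of k] unfolding casimir_normal_form_def by metis
  have AB: "A v = 0 \<and> B v = 0" if v: "v $ 3 > 0" "\<bar>v $ 1\<bar> < (v $ 3) ^ k" for v
  proof -
    \<comment> \<open>The height of the surface over \<open>(x,z)\<close>; the strict bound on
      \<open>x\<close> makes it positive.\<close>
    define y where "y = sqrt ((v $ 3) ^ (2 * k + 1) - v $ 3 * (v $ 1)\<^sup>2)"
    have "(v $ 1)\<^sup>2 < (v $ 3) ^ (2 * k)"
      using power_strict_mono[OF v(2), of 2] by (simp add: mult.commute flip: power_mult)
    then have "v $ 3 * (v $ 1)\<^sup>2 < (v $ 3) ^ (2 * k + 1)" using v(1) by simp
    then have y: "y > 0" "y\<^sup>2 = (v $ 3) ^ (2 * k + 1) - v $ 3 * (v $ 1)\<^sup>2" by (auto simp: y_def)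
    \<comment> \<open>The signs \<open>e = 1\<close> and \<open>e = -1\<close> give two equations
      that separate \<open>A\<close> from \<open>B\<close>, since \<open>y > 0\<close>.\<close>
    have "A v + e * y * B v = 0" if e: "e\<^sup>2 = 1" for e :: real
    proof -
      let ?u = "vector [v $ 1, e * y, v $ 3] :: real^3"
      have u: "?u \<in> D_surf k" using y e by (simp add: D_surf_def power_mult_distrib)
      then have "?u \<in> range (phi k)" using v by (intro D_surf_pos_in_range_phi) auto
      then have "P ?u = 0" using zero by auto
      moreover have "casimir k ?u = 0" using u by (simp add: casimir_def D_surf_def)
      moreover have "A ?u = A v \<and> B ?u = B v" by (rule indep) auto
      ultimately show ?thesis using P_eq[of ?u] by simp
    qed
    from this[of 1] this[of "-1"] y(1) show ?thesis by auto
  qed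
  have "A v = 0" "B v = 0" for v
    using no_middle_variable_zero[OF *(2), of k] no_middle_variable_zero[OF *(3), of k] indep AB by metis+
  then have "P = (\<lambda>v. C v * casimir k v)" by (simp add: P_eq fun_eq_iff)
  with *(1) that show thesis by blast
qed

section \<open>The induced isomorphism\<close>

lemma poly_space_simps [simp]:
  "carrier (poly_space k) = {F. real_polynomial_function F}"
  "mult (poly_space k) = (\<lambda>f g x. f x * g x)" "one (poly_space k) = (\<lambda>x. 1)"
  "zero (poly_space k) = (\<lambda>x. 0)" "add (poly_space k) = (\<lambda>f g x. f x + g x)"
  "smult (poly_space k) = (\<lambda>c f x. c * f x)" "pbracket (poly_space k) = space_bracket k"
  by (simp_all add: poly_space_def fun_alg_def)

lemma A'_simps [simp]:
  "carrier (A' k) = gen_alg (range (\<lambda>i w. phi k w $ i))"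
  "mult (A' k) = (\<lambda>f g x. f x * g x)" "one (A' k) = (\<lambda>x. 1)"
  "zero (A' k) = (\<lambda>x. 0)" "add (A' k) = (\<lambda>f g x. f x + g x)"
  "smult (A' k) = (\<lambda>c f x. c * f x)" "pbracket (A' k) = plane_bracket"
  by (simp_all add: A'_def fun_alg_def)

text \<open>Shared by \<open>poly_space\<close> and \<open>A'\<close>. Constants in the carrier
  provide zero, one and, through multiplication by -1, additive inverses.\<close>

lemma function_ringI:
  fixes R (structure)
  assumes ops: "mult R = (\<lambda>f g x. f x * g x)" "one R = (\<lambda>x. 1 :: real)"
    "zero R = (\<lambda>x. 0)" "add R = (\<lambda>f g x. f x + g x)"
    and closed: "\<And>f g. f \<in> carrier R \<Longrightarrow> g \<in> carrier R \<Longrightarrow> (\<lambda>x. f x * g x) \<in> carrier R"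
    "\<And>f g. f \<in> carrier R \<Longrightarrow> g \<in> carrier R \<Longrightarrow> (\<lambda>x. f x + g x) \<in> carrier R"
    "\<And>c. (\<lambda>x. c) \<in> carrier R"
  shows "ring R"
proof (rule ringI)
  show "abelian_group R"
  proof (rule abelian_groupI)
    fix f assume f: "f \<in> carrier R"
    have "(\<lambda>x. -1 * f x) \<in> carrier R" by (rule closed(1)[OF closed(3) f])
    then show "\<exists>g\<in>carrier R. g \<oplus> f = \<zero>" by (rule bexI[rotated]) (simp add: ops)
  qed (auto simp: ops add_ac intro: closed)
  show "Group.monoid R"
    by (rule monoidI) (auto simp: ops mult_ac intro: closed)
qed (auto simp: ops algebra_simps)

text \<open>Both sides arise from generators by constants, sums and products, and coordinate
  functions pull back to the components of \<open>phi\<close>. This yields surjectivity.\<close>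

lemma gen_alg_eq_pullback_image:
  "gen_alg (range (\<lambda>i w. phi k w $ i)) = pullback k ` {P. real_polynomial_function P}"
proof (intro subset_antisym subsetI)
  fix f assume "f \<in> gen_alg (range (\<lambda>i w. phi k w $ i))"
  then have "\<exists>P. real_polynomial_function P \<and> f = pullback k P"
  proof induction
    case (base f)
    then obtain i where "f = (\<lambda>w. phi k w $ i)" by blast
    then show ?case
      by (intro exI[of _ "\<lambda>v. v $ i"])
        (simp add: fun_eq_iff real_polynomial_function.intros(1) bounded_linear_vec_nth)
  next
    case (const c)
    show ?case
      by (intro exI[of _ "\<lambda>_. c"]) (simp add: fun_eq_iff real_polynomial_function.intros(2))
  next
    case (add f g)
    then obtain P Q where "real_polynomial_function P" "f = pullback k P"
      "real_polynomial_function Q" "g = pullback k Q" by blast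
    then show ?case
      by (intro exI[of _ "\<lambda>v. P v + Q v"]) (simp add: fun_eq_iff real_polynomial_function.intros(3))
  next
    case (mult f g)
    then obtain P Q where "real_polynomial_function P" "f = pullback k P"
      "real_polynomial_function Q" "g = pullback k Q" by blast
    then show ?case
      by (intro exI[of _ "\<lambda>v. P v * Q v"]) (simp add: fun_eq_iff real_polynomial_function.intros(4))
  qed
  then show "f \<in> pullback k ` {P. real_polynomial_function P}" by blast
next
  fix f assume "f \<in> pullback k ` {P. real_polynomial_function P}"
  then obtain P where P: "real_polynomial_function P" and f: "f = (\<lambda>w. P (phi k w))"
    by (auto simp: fun_eq_iff)
  show "f \<in> gen_alg (range (\<lambda>i w. phi k w $ i))"
    using P unfolding f
  proof induction
    case (linear h)
    have c: "(\<lambda>w. phi k w $ i * h (axis i 1)) \<in> gen_alg (range (\<lambda>i w. phi k w $ i))" for i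
      by (intro gen_alg.mult gen_alg.const gen_alg.base) auto
    show ?case
      using gen_alg.add[OF gen_alg.add[OF c[of 1] c[of 2]] c[of 3]]
      by (subst linear_coordinates3[OF bounded_linear.linear[OF linear]])
  qed (auto intro: gen_alg.intros)
qed

lemma real_polynomial_function_space_bracket:
  assumes "real_polynomial_function F" "real_polynomial_function H"
  shows "real_polynomial_function (space_bracket k F H)"
proof -
  note p = real_polynomial_function_partial[OF assms(1)] real_polynomial_function_partial[OF assms(2)]
  have c: "real_polynomial_function (\<lambda>v :: real^3. c)" for c
    by (rule real_polynomial_function.intros)
  show ?thesis
    unfolding space_bracket_def[abs_def] Let_def
    by (intro p c real_polynomial_function_nth real_polynomial_function.intros(3,4) real_polynomial_function_diff
        real_polynomial_function_power)
qed

text \<open>One inclusion is \<open>phi_casimir\<close>, the other \<open>phi_kernel\<close>.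
  Divisibility by the Casimir function thus becomes vanishing of the pull-back.\<close>

lemma casimir_ideal_eq:
  "casimir_ideal k = {P. real_polynomial_function P \<and> (\<forall>w. P (phi k w) = 0)}"
proof -
  have "(\<lambda>v. C v * casimir k v) \<in> {P. real_polynomial_function P \<and> (\<forall>w. P (phi k w) = 0)}"
    if "real_polynomial_function C" for C
    using that by (simp add: phi_casimir real_polynomial_function.intros(4) real_polynomial_function_casimir)
  moreover have "\<exists>C. P = (\<lambda>v. C v * casimir k v) \<and> real_polynomial_function C"
    if "real_polynomial_function P" "\<And>w. P (phi k w) = 0" for P
    using phi_kernel[OF that] by blast
  ultimately show ?thesis
    unfolding casimir_ideal_def cgenideal_def poly_space_simps by blast
qed

lemma pullback_ring_hom_ring: "ring_hom_ring (poly_space k) (A' k) (pullback k)"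
proof (rule ring_hom_ringI2)
  show "ring (poly_space k)"
    by (rule function_ringI) (simp_all add: real_polynomial_function.intros(2-4))
  show "ring (A' k)"
    by (rule function_ringI) (simp_all add: gen_alg.const gen_alg.add gen_alg.mult)
  show "pullback k \<in> ring_hom (poly_space k) (A' k)"
    by (rule ring_hom_memI) (auto simp: gen_alg_eq_pullback_image fun_eq_iff)
qed

lemma pullback_kernel: "a_kernel (poly_space k) (A' k) (pullback k) = casimir_ideal k"
  by (auto simp: a_kernel_def' casimir_ideal_eq fun_eq_iff)

text \<open>Cosets of a kernel are fibres, so independence of representatives reduces to equality of
  pull-backs.\<close>

lemma casimir_coset:
  assumes "real_polynomial_function P"
  shows "casimir_ideal k +>\<^bsub>poly_space k\<^esub> P =
    {Q. real_polynomial_function Q \<and> pullback k Q = pullback k P}"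
  using ring_hom_ring.rcos_eq_homeq[OF pullback_ring_hom_ring, of P k] assms
  by (simp add: pullback_kernel)

text \<open>The pull-back is constant on a coset, so \<open>the_elem\<close> is applied to a
  singleton.\<close>

lemma pullback_quot_coset:
  assumes "real_polynomial_function P"
  shows "pullback_quot k (casimir_ideal k +>\<^bsub>poly_space k\<^esub> P) = pullback k P"
  using ring_hom_ring.the_elem_simp[OF pullback_ring_hom_ring, of P k] assms
  by (simp add: pullback_kernel pullback_quot_def)

lemma F_D_carrier:
  "carrier (F_D k) = {casimir_ideal k +>\<^bsub>poly_space k\<^esub> P | P. real_polynomial_function P}"
  by (auto simp: F_D_def quot_alg_def FactRing_def A_RCOSETS_def')

text \<open>All representatives contribute the same coset, and there is at least one, so the union
  in \<open>quot_alg\<close> collapses.\<close>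

lemma F_D_smult:
  assumes "real_polynomial_function P"
  shows "smult (F_D k) c (casimir_ideal k +>\<^bsub>poly_space k\<^esub> P) =
    casimir_ideal k +>\<^bsub>poly_space k\<^esub> (\<lambda>v. c * P v)"
proof -
  have c: "real_polynomial_function (\<lambda>v. c * Q v)" if "real_polynomial_function Q" for Q
    by (rule real_polynomial_function.intros(4)[OF real_polynomial_function.intros(2) that])
  have const: "casimir_ideal k +>\<^bsub>poly_space k\<^esub> (\<lambda>v. c * Q v) = casimir_ideal k +>\<^bsub>poly_space k\<^esub> (\<lambda>v. c * P v)"
    if "Q \<in> casimir_ideal k +>\<^bsub>poly_space k\<^esub> P" for Q
  proof -
    have "real_polynomial_function Q" "pullback k Q = pullback k P"
      using that by (simp_all add: casimir_coset[OF assms])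
    then show ?thesis
      by (simp add: casimir_coset c assms fun_eq_iff)
  qed
  have "P \<in> casimir_ideal k +>\<^bsub>poly_space k\<^esub> P"
    using assms by (simp add: casimir_coset)
  then have ne: "casimir_ideal k +>\<^bsub>poly_space k\<^esub> P \<noteq> {}" by blast
  have "smult (F_D k) c X = (\<Union>Q\<in>X. casimir_ideal k +>\<^bsub>poly_space k\<^esub> (\<lambda>v. c * Q v))" for X
    by (simp add: F_D_def quot_alg_def)
  then show ?thesis by (rule trans) (rule SUP_eq_const[OF ne const])
qed

lemma pullback_space_bracket_poly:
  assumes "real_polynomial_function P" "real_polynomial_function Q" "k > 0"
  shows "pullback k (space_bracket k P Q) = plane_bracket (pullback k P) (pullback k Q)"
  by (rule pullback_space_bracket[symmetric])
    (use assms in \<open>auto intro: differentiable_at_real_polynomial_function\<close>)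

text \<open>The ideal is the kernel of a bracket-preserving map, so the bracket descends without
  computing that the Casimir function has vanishing brackets.\<close>

lemma F_D_pbracket:
  assumes P: "real_polynomial_function P" and Q: "real_polynomial_function Q" and k: "k > 0"
  shows "pbracket (F_D k) (casimir_ideal k +>\<^bsub>poly_space k\<^esub> P) (casimir_ideal k +>\<^bsub>poly_space k\<^esub> Q) =
    casimir_ideal k +>\<^bsub>poly_space k\<^esub> space_bracket k P Q"
proof -
  have const: "casimir_ideal k +>\<^bsub>poly_space k\<^esub> space_bracket k P' Q' =
      casimir_ideal k +>\<^bsub>poly_space k\<^esub> space_bracket k P Q"
    if "P' \<in> casimir_ideal k +>\<^bsub>poly_space k\<^esub> P" "Q' \<in> casimir_ideal k +>\<^bsub>poly_space k\<^esub> Q" for P' Q'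
  proof -
    have *: "real_polynomial_function P'" "pullback k P' = pullback k P"
      "real_polynomial_function Q'" "pullback k Q' = pullback k Q"
      using that by (simp_all add: casimir_coset P Q)
    then have "pullback k (space_bracket k P' Q') = pullback k (space_bracket k P Q)"
      by (simp only: pullback_space_bracket_poly P Q k)
    then show ?thesis
      by (simp only: casimir_coset real_polynomial_function_space_bracket P Q *)
  qed
  have "P \<in> casimir_ideal k +>\<^bsub>poly_space k\<^esub> P" "Q \<in> casimir_ideal k +>\<^bsub>poly_space k\<^esub> Q"
    using P Q by (simp_all add: casimir_coset)
  then have ne: "casimir_ideal k +>\<^bsub>poly_space k\<^esub> P \<noteq> {}" "casimir_ideal k +>\<^bsub>poly_space k\<^esub> Q \<noteq> {}"
    by blast+
  have "pbracket (F_D k) X Y =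
      (\<Union>P'\<in>X. \<Union>Q'\<in>Y. casimir_ideal k +>\<^bsub>poly_space k\<^esub> space_bracket k P' Q')" for X Y
    by (simp add: F_D_def quot_alg_def)
  then show ?thesis by (rule trans) (intro SUP_eq_const ne const)
qed

text \<open>The first isomorphism theorem gives the ring isomorphism; scalars and brackets are then
  checked on representatives.\<close>

lemma pullback_quot_poisson_iso:
  assumes k: "k > 0"
  shows "pullback_quot k \<in> poisson_iso (F_D k) (A' k)"
proof -
  have eq: "pullback_quot k = (\<lambda>X. the_elem (pullback k ` X))"
    by (simp add: fun_eq_iff pullback_quot_def)
  have iso: "pullback_quot k \<in> ring_iso (poly_space k Quot casimir_ideal k) (A' k)"
    using ring_hom_ring.FactRing_iso_set[OF pullback_ring_hom_ring, of k]
    by (simp add: pullback_kernel gen_alg_eq_pullback_image eq)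
  have "pullback_quot k \<in> ring_hom (F_D k) (A' k)"
    using iso by (simp add: ring_iso_def ring_hom_def F_D_def quot_alg_def)
  moreover have "pullback_quot k (smult (F_D k) c X) = smult (A' k) c (pullback_quot k X)"
    if X: "X \<in> carrier (F_D k)" for c X
  proof -
    obtain P where P: "X = casimir_ideal k +>\<^bsub>poly_space k\<^esub> P" "real_polynomial_function P"
      using X unfolding F_D_carrier by blast
    have "real_polynomial_function (\<lambda>v. c * P v)"
      by (rule real_polynomial_function.intros(4)[OF real_polynomial_function.intros(2) P(2)])
    from pullback_quot_coset[OF this] P show ?thesis
      by (simp add: F_D_smult pullback_quot_coset fun_eq_iff)
  qed
  ultimately have hom: "pullback_quot k \<in> alg_hom (F_D k) (A' k)"
    by (simp add: alg_hom_def)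
  have "pullback_quot k (pbracket (F_D k) X Y) = pbracket (A' k) (pullback_quot k X) (pullback_quot k Y)"
    if "X \<in> carrier (F_D k)" "Y \<in> carrier (F_D k)" for X Y
    using that by (auto simp: F_D_carrier F_D_pbracket[OF _ _ k] pullback_quot_coset
        real_polynomial_function_space_bracket pullback_space_bracket_poly[OF _ _ k])
  with hom have "pullback_quot k \<in> poisson_hom (F_D k) (A' k)"
    by (simp add: poisson_hom_def)
  moreover have "bij_betw (pullback_quot k) (carrier (F_D k)) (carrier (A' k))"
    using iso by (simp add: ring_iso_def F_D_def quot_alg_def)
  moreover have "bracket_closed (F_D k)"
    unfolding bracket_closed_def F_D_carrier
    using F_D_pbracket[OF _ _ k] real_polynomial_function_space_bracket by blast
  \<comment> \<open>Elements of \<open>A'\<close> are pull-backs of polynomials, and their bracket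
    is the pull-back of the polynomial bracket.\<close>
  moreover have "bracket_closed (A' k)"
    unfolding bracket_closed_def A'_simps gen_alg_eq_pullback_image
    using pullback_space_bracket_poly[OF _ _ k, symmetric] real_polynomial_function_space_bracket
    by fastforce
  ultimately show ?thesis by (simp add: poisson_iso_def)
qed

text \<open>The third conjunct ties the isomorphism to the morphism: it is the map induced by
  restricting the pull-back to polynomials.\<close>

theorem proposition4p9:
  fixes k :: nat
  assumes "k \<ge> 2"
  shows "range (phi_bar k) \<subseteq> D_plus k
    \<and> pullback k \<in> poisson_hom (C_inf_space k) (C_quot (k div 2))
    \<and> (\<forall>P\<in>carrier (poly_space k).
          P \<in> carrier (C_inf_space k) \<and>
          pullback_quot k (casimir_ideal k +>\<^bsub>poly_space k\<^esub> P) = pullback k P)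
    \<and> pullback_quot k \<in> poisson_iso (F_D k) (A' k)"
proof (intro conjI ballI)
  have "phi_bar k x \<in> D_plus k" for x
    by transfer (rule phi_in_D_plus)
  then show "range (phi_bar k) \<subseteq> D_plus k" by blast
  show "pullback k \<in> poisson_hom (C_inf_space k) (C_quot (k div 2))"
    by (rule pullback_poisson_hom) (use assms in linarith)
  show "pullback_quot k \<in> poisson_iso (F_D k) (A' k)"
    by (rule pullback_quot_poisson_iso) (use assms in linarith)
  fix P assume "P \<in> carrier (poly_space k)"
  then have P: "real_polynomial_function P" by simp
  then show "P \<in> carrier (C_inf_space k)"
    by (simp add: C_inf_space_def fun_alg_def smooth_on_real_polynomial_function)
  show "pullback_quot k (casimir_ideal k +>\<^bsub>poly_space k\<^esub> P) = pullback k P"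
    by (rule pullback_quot_coset[OF P])
qed

end
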